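(* Let $\Bbbk$ be a nonzero commutative ring and let $G$ be a finitely generated group with a fixed finite generating set $S$. Let $(\Bbbk G)_0$ be the $\Bbbk$-algebra which is free as a $\Bbbk$-module with basis $\{\delta_g\}_{g\in G}$ and has multiplication $\delta_g\delta_h=\delta_{gh}$ if $\ell(gh)=\ell(g)+\ell(h)$ and $\delta_g\delta_h=0$ otherwise, where $\ell$ is the word length with respect to $S$. (1) If $G$ is amenable, or if $G$ has a dead end (with respect to $S$), then $(\Bbbk G)_0$ is amenable. (2) If $G$ is amenable, or if $G$ has infinitely many dead ends (with respect to $S$), then $(\Bbbk G)_0$ is exhaustively amenable.
   Context: The generating set $S$ is such that every element of $G$ is a product of elements of $S$ (e.g. $S$ is closed under inverses), and $\ell(g)=\min\{n:\ g=s_1\cdots s_n,\ s_i\in S\}$. An element $g\in G$ is a dead end (with respect to $S$) if $\ell(gs)\le\ell(g)$ for all $s\in S$. For a $\Bbbk$-module $M$, $\operatorname{rank}(M)$ denotes its minimal number of generators; "subspace" means $\Bbbk$-submodule. For a right module $M$ over a $\Bbbk$-algebra $R$, and subspaces $F\le M$, $S'\le R$, $FS'$ denotes the $\Bbbk$-span of all products $fs$ with $f\in F$, $s\in S'$. The right $R$-module $M$ is amenable if for every $\epsilon>0$ and every finite-rank subspace $S'$ of $R$ there exists a finite-rank subspace $F$ of $M$ such that $\frac{\operatorname{rank}(F+FS')-\operatorname{rank}(F)}{\operatorname{rank}(F)}<\epsilon$ (in particular $\operatorname{rank}(F)>0$). It is exhaustively amenable if moreover, for any specified finite-rank subspace $E\le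 M$, such an $F$ can be chosen to contain $E$. An algebra $R$ is called (exhaustively) amenable if it is so as a right module over itself. A group $G$ is amenable (Følner) if for every $\epsilon>0$ and every finite $K\subset G$ there is a finite nonempty $F\subset G$ with $(\#(F\cup FK)-\#F)/\#F<\epsilon$. *)

theory Defs
  imports Complex_Main "HOL-Library.Poly_Mapping"
begin

section \<open>Finite-rank submodules and rank\<close>

context module
begin

definition finite_rank_subspace :: "'b set \<Rightarrow> bool"
  where "finite_rank_subspace F \<longleftrightarrow> subspace F \<and> (\<exists>B. finite B \<and> span B = F)"

text \<open>Only meaningful for a finitely generated \<open>F\<close>.\<close>

definition rank :: "'b set \<Rightarrow> nat"
  where "rank F = (LEAST n. \<exists>B. finite B \<and> card B = n \<and> span B = F)"

end


section \<open>Amenable modules and algebras\<close>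

text \<open>Associative unital algebras over a commutative ring. The operations are explicit parameters
  because the product considered below depends on the generating set and hence cannot be
  a type class instance.\<close>

locale algebra_over = module scale
  for scale :: "'k::comm_ring_1 \<Rightarrow> 'r::ab_group_add \<Rightarrow> 'r" +
  fixes mult :: "'r \<Rightarrow> 'r \<Rightarrow> 'r" and unit :: 'r
  assumes mult_add_left: "mult (x + y) z = mult x z + mult y z"
    and mult_add_right: "mult x (y + z) = mult x y + mult x z"
    and mult_scale_left: "mult (scale c x) y = scale c (mult x y)"
    and mult_scale_right: "mult x (scale c y) = scale c (mult x y)"
    and mult_assoc: "mult (mult x y) z = mult x (mult y z)"
    and unit_left: "mult unit x = x"
    and unit_right: "mult x unit = x"

locale right_module_over =
  R: algebra_over scaleR mult unit + M: module scaleM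
  for scaleR :: "'k::comm_ring_1 \<Rightarrow> 'r::ab_group_add \<Rightarrow> 'r"
    and mult :: "'r \<Rightarrow> 'r \<Rightarrow> 'r" and unit :: 'r
    and scaleM :: "'k \<Rightarrow> 'm::ab_group_add \<Rightarrow> 'm" +
  fixes act :: "'m \<Rightarrow> 'r \<Rightarrow> 'm"
  assumes act_add_left: "act (x + y) r = act x r + act y r"
    and act_add_right: "act x (r + s) = act x r + act x s"
    and act_scale_left: "act (scaleM c x) r = scaleM c (act x r)"
    and act_scale_right: "act x (scaleR c r) = scaleM c (act x r)"
    and act_mult: "act x (mult r s) = act (act x r) s"
    and act_unit: "act x unit = x"
begin

definition subspace_product :: "'m set \<Rightarrow> 'r set \<Rightarrow> 'm set"
  where "subspace_product F S = M.span {act f s | f s. f \<in> F \<and> s \<in> S}"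

text \<open>\<open>rank (F + FS) - rank F\<close> is taken in the reals, since over a general commutative ring it may
  be negative.\<close>

definition almost_invariant :: "real \<Rightarrow> 'r set \<Rightarrow> 'm set \<Rightarrow> bool"
  where "almost_invariant \<epsilon> S F \<longleftrightarrow>
    M.finite_rank_subspace F \<and> M.rank F > 0 \<and>
    (real (M.rank {x + y | x y. x \<in> F \<and> y \<in> subspace_product F S}) - real (M.rank F))
      / real (M.rank F) < \<epsilon>"

definition amenable_module :: bool
  where "amenable_module \<longleftrightarrow>
    (\<forall>\<epsilon>>0. \<forall>S. R.finite_rank_subspace S \<longrightarrow> (\<exists>F. almost_invariant \<epsilon> S F))"

definition exhaustively_amenable_module :: bool
  where "exhaustively_amenable_module \<longleftrightarrow>
    (\<forall>\<epsilon>>0. \<forall>S. R.finite_rank_subspace S \<longrightarrow>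
      (\<forall>E. M.finite_rank_subspace E \<longrightarrow> (\<exists>F. E \<subseteq> F \<and> almost_invariant \<epsilon> S F)))"

end

context algebra_over
begin

lemma right_module_over_itself: "right_module_over scale mult unit scale mult"
  by unfold_locales
    (simp_all add: mult_add_left mult_add_right mult_scale_left mult_scale_right mult_assoc unit_right)

definition amenable_algebra :: bool
  where "amenable_algebra \<longleftrightarrow> right_module_over.amenable_module scale scale mult"

definition exhaustively_amenable_algebra :: bool
  where "exhaustively_amenable_algebra \<longleftrightarrow>
    right_module_over.exhaustively_amenable_module scale scale mult"

end


section \<open>Groups, word length and dead ends\<close>

text \<open>Groups are rendered by the class \<^class>\<open>group_add\<close>: it is written additively, but
  commutativity is not assumed. The product \<open>gh\<close> is \<open>g + h\<close> and the identity is \<open>0\<close>.\<close>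

definition amenable_group :: "'g::group_add itself \<Rightarrow> bool"
  where "amenable_group _ \<longleftrightarrow>
    (\<forall>\<epsilon>>0. \<forall>K::'g set. finite K \<longrightarrow>
      (\<exists>F. finite F \<and> F \<noteq> {} \<and>
        (real (card (F \<union> {f + k | f k. f \<in> F \<and> k \<in> K})) - real (card F)) / real (card F) < \<epsilon>))"

definition generates :: "'g::group_add set \<Rightarrow> bool"
  where "generates S \<longleftrightarrow> (\<forall>g. \<exists>ws. set ws \<subseteq> S \<and> sum_list ws = g)"

text \<open>The empty word is allowed, so the identity has length \<open>0\<close>.\<close>

definition word_length :: "'g::group_add set \<Rightarrow> 'g \<Rightarrow> nat"
  where "word_length S g = (LEAST n. \<exists>ws. length ws = n \<and> set ws \<subseteq> S \<and> sum_list ws = g)"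

definition dead_end :: "'g::group_add set \<Rightarrow> 'g \<Rightarrow> bool"
  where "dead_end S g \<longleftrightarrow> (\<forall>s\<in>S. word_length S (g + s) \<le> word_length S g)"


section \<open>The algebra \<open>(kG)\<^sub>0\<close>\<close>

text \<open>The free module on the group is \<open>'g \<Rightarrow>\<^sub>0 'k\<close>, with basis element \<open>\<delta>\<^sub>g\<close> being
  \<open>Poly_Mapping.single g 1\<close>. The library's own product on this type is that of the ordinary group
  algebra; it is not used here.\<close>

definition kG0_scale :: "'k::comm_ring_1 \<Rightarrow> ('g \<Rightarrow>\<^sub>0 'k) \<Rightarrow> ('g \<Rightarrow>\<^sub>0 'k)"
  where "kG0_scale c p = Poly_Mapping.map ((*) c) p"

definition kG0_mult :: "'g::group_add set \<Rightarrow> ('g \<Rightarrow>\<^sub>0 'k::comm_ring_1) \<Rightarrow> ('g \<Rightarrow>\<^sub>0 'k) \<Rightarrow> ('g \<Rightarrow>\<^sub>0 'k)"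
  where "kG0_mult S p q =
    (\<Sum>g\<in>Poly_Mapping.keys p. \<Sum>h\<in>Poly_Mapping.keys q.
      if word_length S (g + h) = word_length S g + word_length S h
      then Poly_Mapping.single (g + h) (Poly_Mapping.lookup p g * Poly_Mapping.lookup q h)
      else 0)"

lemma kG0_mult_basis:
  "kG0_mult S (Poly_Mapping.single g (1::'k::comm_ring_1)) (Poly_Mapping.single h 1) =
    (if word_length S (g + h) = word_length S g + word_length S h
     then Poly_Mapping.single (g + h) 1 else 0)"
  by (simp add: kG0_mult_def)

lemma lookup_kG0_scale [simp]:
  "Poly_Mapping.lookup (kG0_scale c p) g = c * Poly_Mapping.lookup p g"
  unfolding kG0_scale_def by transfer (simp add: when_def)

lemma module_kG0: "module (kG0_scale :: 'k::comm_ring_1 \<Rightarrow> ('g \<Rightarrow>\<^sub>0 'k) \<Rightarrow> _)"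
  by unfold_locales (auto intro!: poly_mapping_eqI simp: lookup_add algebra_simps)

lemma word_length_attained:
  assumes "generates S"
  obtains ws where "length ws = word_length S g" "set ws \<subseteq> S" "sum_list ws = g"
proof -
  obtain ws where "set ws \<subseteq> S" "sum_list ws = g"
    using assms unfolding generates_def by blast
  then have "\<exists>n ws. length ws = n \<and> set ws \<subseteq> S \<and> sum_list ws = g"
    by blast
  from LeastI_ex [OF this] show ?thesis
    using that unfolding word_length_def by blast
qed

lemma word_length_le:
  "set ws \<subseteq> S \<Longrightarrow> sum_list ws = g \<Longrightarrow> word_length S g \<le> length ws"
  unfolding word_length_def by (rule Least_le) blast

lemma word_length_zero [simp]: "word_length S 0 = 0"
  using word_length_le [of "[]" S 0] by simp

lemma word_length_add_le:
  assumes "generates S"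
  shows "word_length S (g + h) \<le> word_length S g + word_length S h"
proof -
  obtain us where us: "length us = word_length S g" "set us \<subseteq> S" "sum_list us = g"
    using word_length_attained [OF assms] .
  obtain vs where vs: "length vs = word_length S h" "set vs \<subseteq> S" "sum_list vs = h"
    using word_length_attained [OF assms] .
  show ?thesis
    using word_length_le [of "us @ vs" S "g + h"] us vs by simp
qed

lemma kG0_mult_superset:
  assumes "finite A" "Poly_Mapping.keys p \<subseteq> A" "finite B" "Poly_Mapping.keys q \<subseteq> B"
  shows "kG0_mult S p q =
    (\<Sum>g\<in>A. \<Sum>h\<in>B.
      if word_length S (g + h) = word_length S g + word_length S h
      then Poly_Mapping.single (g + h) (Poly_Mapping.lookup p g * Poly_Mapping.lookup q h)
      else 0)" (is "_ = (\<Sum>g\<in>A. \<Sum>h\<in>B. ?t g h)")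
proof -
  have "kG0_mult S p q = (\<Sum>g\<in>Poly_Mapping.keys p. \<Sum>h\<in>B. ?t g h)"
    unfolding kG0_mult_def
    by (intro sum.cong refl sum.mono_neutral_left) (use assms in \<open>auto simp: in_keys_iff\<close>)
  also have "\<dots> = (\<Sum>g\<in>A. \<Sum>h\<in>B. ?t g h)"
    by (intro sum.mono_neutral_left) (use assms in \<open>auto simp: in_keys_iff intro!: sum.neutral\<close>)
  finally show ?thesis .
qed

lemma kG0_mult_add_left: "kG0_mult S (p + p') q = kG0_mult S p q + kG0_mult S p' q"
proof -
  let ?A = "Poly_Mapping.keys p \<union> Poly_Mapping.keys p'" and ?B = "Poly_Mapping.keys q"
  have *: "kG0_mult S r q = (\<Sum>g\<in>?A. \<Sum>h\<in>?B.
      if word_length S (g + h) = word_length S g + word_length S h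
      then Poly_Mapping.single (g + h) (Poly_Mapping.lookup r g * Poly_Mapping.lookup q h)
      else 0)" if "Poly_Mapping.keys r \<subseteq> ?A" for r
    by (rule kG0_mult_superset) (use that in auto)
  show ?thesis
    unfolding *[OF keys_add] *[OF Un_upper1] *[OF Un_upper2] sum.distrib [symmetric]
    by (intro sum.cong refl) (auto simp: lookup_add distrib_right single_add)
qed

lemma kG0_mult_add_right: "kG0_mult S q (p + p') = kG0_mult S q p + kG0_mult S q p'"
proof -
  let ?A = "Poly_Mapping.keys p \<union> Poly_Mapping.keys p'" and ?B = "Poly_Mapping.keys q"
  have *: "kG0_mult S q r = (\<Sum>g\<in>?B. \<Sum>h\<in>?A.
      if word_length S (g + h) = word_length S g + word_length S h
      then Poly_Mapping.single (g + h) (Poly_Mapping.lookup q g * Poly_Mapping.lookup r h)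
      else 0)" if "Poly_Mapping.keys r \<subseteq> ?A" for r
    by (rule kG0_mult_superset) (use that in auto)
  show ?thesis
    unfolding *[OF keys_add] *[OF Un_upper1] *[OF Un_upper2] sum.distrib [symmetric]
    by (intro sum.cong refl) (auto simp: lookup_add distrib_left single_add)
qed

lemma kG0_scale_single: "kG0_scale c (Poly_Mapping.single g a) = Poly_Mapping.single g (c * a)"
  by (rule poly_mapping_eqI) (auto simp: lookup_single when_def)

lemma keys_kG0_scale: "Poly_Mapping.keys (kG0_scale c p) \<subseteq> Poly_Mapping.keys p"
  by (auto simp: in_keys_iff)

lemma kG0_scale_sum: "kG0_scale c (sum f A) = (\<Sum>x\<in>A. kG0_scale c (f x))"
  by (rule poly_mapping_eqI) (simp add: lookup_sum sum_distrib_left)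

lemma kG0_scale_zero: "kG0_scale c 0 = 0"
  by (rule poly_mapping_eqI) simp

lemma kG0_mult_scale_left: "kG0_mult S (kG0_scale c p) q = kG0_scale c (kG0_mult S p q)"
  unfolding kG0_mult_superset [OF finite_keys keys_kG0_scale finite_keys order_refl, of S c p q]
    kG0_mult_def [of S p q] kG0_scale_sum
  by (intro sum.cong refl) (auto simp: kG0_scale_single kG0_scale_zero mult.assoc)

lemma kG0_mult_scale_right: "kG0_mult S p (kG0_scale c q) = kG0_scale c (kG0_mult S p q)"
  unfolding kG0_mult_superset [OF finite_keys order_refl finite_keys keys_kG0_scale, of S p c q]
    kG0_mult_def [of S p q] kG0_scale_sum
  by (intro sum.cong refl) (auto simp: kG0_scale_single kG0_scale_zero mult.left_commute)

lemma kG0_mult_single: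
  "kG0_mult S (Poly_Mapping.single g a) (Poly_Mapping.single h b) =
    (if word_length S (g + h) = word_length S g + word_length S h
     then Poly_Mapping.single (g + h) (a * b) else 0)"
  by (subst kG0_mult_superset [where A = "{g}" and B = "{h}"]) auto

lemma kG0_mult_zero [simp]: "kG0_mult S 0 q = 0" "kG0_mult S p 0 = 0"
  by (simp_all add: kG0_mult_def)

lemma kG0_induct [case_names zero single add]:
  assumes "P 0" "\<And>g a. P (Poly_Mapping.single g a)" "\<And>p q. P p \<Longrightarrow> P q \<Longrightarrow> P (p + q)"
  shows "P (p :: 'g \<Rightarrow>\<^sub>0 'k::comm_ring_1)"
proof -
  have "P (\<Sum>g\<in>A. Poly_Mapping.single g (Poly_Mapping.lookup p g))" if "finite A" for A
    using that by induction (use assms in auto)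
  moreover have "(\<Sum>g\<in>Poly_Mapping.keys p. Poly_Mapping.single g (Poly_Mapping.lookup p g)) = p"
    by (rule poly_mapping_eqI)
      (auto simp: lookup_sum lookup_single when_def sum.delta' in_keys_iff)
  ultimately show ?thesis
    by (metis finite_keys)
qed

lemma kG0_mult_assoc:
  assumes "generates S"
  shows "kG0_mult S (kG0_mult S p q) r = kG0_mult S p (kG0_mult S q r)"
proof (induction p rule: kG0_induct)
  case (single g a)
  show ?case
  proof (induction q rule: kG0_induct)
    case (single h b)
    show ?case
    proof (induction r rule: kG0_induct)
      case (single k c)
      show ?case
        using word_length_add_le [OF assms, of g h] word_length_add_le [OF assms, of h k]
          word_length_add_le [OF assms, of "g + h" k] word_length_add_le [OF assms, of g "h + k"]
        by (auto simp: kG0_mult_single add.assoc mult.assoc)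
    qed (simp_all add: kG0_mult_add_right)
  qed (simp_all add: kG0_mult_add_right kG0_mult_add_left)
qed (simp_all add: kG0_mult_add_left)

lemma algebra_kG0:
  assumes "generates (S :: 'g::group_add set)"
  shows "algebra_over (kG0_scale :: 'k::comm_ring_1 \<Rightarrow> ('g \<Rightarrow>\<^sub>0 'k) \<Rightarrow> _) (kG0_mult S)
    (Poly_Mapping.single 0 1)"
proof -
  interpret module "kG0_scale :: 'k \<Rightarrow> ('g \<Rightarrow>\<^sub>0 'k) \<Rightarrow> _"
    by (rule module_kG0)
  have "kG0_mult S (Poly_Mapping.single 0 1) p = p" for p :: "'g \<Rightarrow>\<^sub>0 'k"
    by (induction p rule: kG0_induct) (simp_all add: kG0_mult_single kG0_mult_add_right del: single_one)
  moreover have "kG0_mult S p (Poly_Mapping.single 0 1) = p" for p :: "'g \<Rightarrow>\<^sub>0 'k"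
    by (induction p rule: kG0_induct) (simp_all add: kG0_mult_single kG0_mult_add_left del: single_one)
  ultimately show ?thesis
    by unfold_locales
      (simp_all add: kG0_mult_add_left kG0_mult_add_right kG0_mult_scale_left
        kG0_mult_scale_right kG0_mult_assoc [OF assms] del: single_one)
qed

end

(* The test subspaces are the coordinate subspaces k^A for finite subsets A of G. If S' is spanned by t
   elements supported in K, and B is the set of those x in A for which some nonzero product
   \<delta>_x \<delta>_k (k in K) leaves k^A, then k^A + k^A S' is generated by |A| + t |B| elements, while
   rank (k^A) = |A| because k is a nonzero commutative ring. So it is enough to find A, possibly containing
   a prescribed finite set X, with |B| / |A| small. For amenable G, a Foelner set that is large compared with
   X is enlarged by X. If g is a dead end then \<delta>_g \<delta>_k = 0 for all k \<noteq> 1, so dead ends never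
   belong to B, and A can be X together with many dead ends. *)

theory Submission
  imports Defs "Jordan_Normal_Form.Determinant"
begin

section \<open>Rank of coordinate subspaces\<close>

text \<open>An identity matrix of size \<open>card A\<close> cannot factor through fewer than
  \<open>card A\<close> coordinates. Determinants serve as the substitute for a dimension argument
  over a general commutative ring.\<close>

lemma card_le_of_identity_factorization:
  fixes c :: "'a \<Rightarrow> 'b \<Rightarrow> 'k::comm_ring_1" and d :: "'b \<Rightarrow> 'a \<Rightarrow> 'k"
  assumes "finite A" "finite B"
    and id: "\<And>x y. x \<in> A \<Longrightarrow> y \<in> A \<Longrightarrow> (\<Sum>b\<in>B. c x b * d b y) = (if x = y then 1 else 0)"
  shows "card A \<le> card B"
proof (rule ccontr)
  define n m where "n = card A" and "m = card B"
  assume "\<not> card A \<le> card B"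
  then have mn: "m < n" by (simp add: n_def m_def)
  obtain f where f: "bij_betw f {0..<n} A"
    using ex_bij_betw_nat_finite [OF \<open>finite A\<close>] unfolding n_def by blast
  obtain h where h: "bij_betw h {0..<m} B"
    using ex_bij_betw_nat_finite [OF \<open>finite B\<close>] unfolding m_def by blast
  \<comment> \<open>Padding by zeros makes both factors square, so that determinants apply.\<close>
  define P where "P = mat n n (\<lambda>(i, l). if l < m then c (f i) (h l) else 0)"
  define Q where "Q = mat n n (\<lambda>(l, j). if l < m then d (h l) (f j) else 0)"
  have P: "P \<in> carrier_mat n n" and Q: "Q \<in> carrier_mat n n"
    by (simp_all add: P_def Q_def)
  have "P * Q = 1\<^sub>m n"
  proof (rule eq_matI)
    fix i j assume "i < dim_row (1\<^sub>m n)" "j < dim_col (1\<^sub>m n)"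
    then have ij: "i < n" "j < n" by auto
    then have "(P * Q) $$ (i, j) = (\<Sum>l = 0..<n. if l < m then c (f i) (h l) * d (h l) (f j) else 0)"
      by (auto simp: P_def Q_def scalar_prod_def intro!: sum.cong)
    also have "\<dots> = (\<Sum>l = 0..<m. c (f i) (h l) * d (h l) (f j))"
      using mn by (intro sum.mono_neutral_cong_right) auto
    also have "\<dots> = (\<Sum>b\<in>B. c (f i) b * d b (f j))"
      by (rule sum.reindex_bij_betw [OF h])
    also have "\<dots> = (if f i = f j then 1 else 0)"
      using ij f by (intro id) (auto simp: bij_betw_def)
    also have "f i = f j \<longleftrightarrow> i = j"
      using ij f by (auto simp: bij_betw_def inj_on_def)
    finally show "(P * Q) $$ (i, j) = 1\<^sub>m n $$ (i, j)"
      using ij by simp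
  qed (use P Q in auto)
  then have "det P * det Q = 1"
    using det_mult [OF P Q] by simp
  \<comment> \<open>Row \<open>m\<close> of \<open>Q\<close> consists of padding, so every term of
    the Leibniz expansion contains a zero factor. The resulting equation 0 = 1 is absurd because the
    ring is nonzero.\<close>
  moreover have "det Q = 0"
    unfolding det_def' [OF Q]
  proof (intro sum.neutral ballI)
    fix p assume "p \<in> {p. p permutes {0..<n}}"
    then have "p m < n"
      using mn permutes_in_image [of p "{0..<n}" m] by auto
    then have "(\<Prod>i = 0..<n. Q $$ (i, p i)) = 0"
      using mn by (intro prod_zero) (auto simp: Q_def intro!: bexI [of _ m])
    then show "signof p * (\<Prod>i = 0..<n. Q $$ (i, p i)) = 0" by simp
  qed
  ultimately show False by simp
qed

lemma (in Modules.module) rank_span_le_card: "finite B \<Longrightarrow> rank (span B) \<le> card B"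
  unfolding rank_def by (rule Least_le) blast

lemma (in Modules.module) rank_attained:
  assumes "finite B"
  obtains B' where "finite B'" "card B' = rank (span B)" "span B' = span B"
proof -
  have "\<exists>n B'. finite B' \<and> card B' = n \<and> span B' = span B"
    using assms by blast
  from LeastI_ex [OF this] show ?thesis
    using that unfolding rank_def by blast
qed

section \<open>The coordinate subspaces k^A and their rank\<close>

definition supported :: "'g set \<Rightarrow> ('g \<Rightarrow>\<^sub>0 'k::comm_ring_1) set"
  where "supported A = {p. Poly_Mapping.keys p \<subseteq> A}"

abbreviation delta :: "'g \<Rightarrow> 'g \<Rightarrow>\<^sub>0 'k::comm_ring_1"
  where "delta g \<equiv> Poly_Mapping.single g 1"

interpretation kG0: Modules.module "kG0_scale :: 'k::comm_ring_1 \<Rightarrow> ('g \<Rightarrow>\<^sub>0 'k) \<Rightarrow> _"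
  by (rule module_kG0)

lemma sum_single_lookup:
  assumes "finite A" "Poly_Mapping.keys p \<subseteq> A"
  shows "(\<Sum>g\<in>A. Poly_Mapping.single g (Poly_Mapping.lookup p g)) = p"
  using assms by (intro poly_mapping_eqI)
    (auto simp: lookup_sum lookup_single when_def sum.delta' in_keys_iff)

lemma subspace_supported: "kG0.subspace (supported A)"
  by (auto simp: kG0.subspace_def supported_def
    dest!: subsetD [OF keys_add] subsetD [OF keys_kG0_scale])

lemma span_delta: "kG0.span (delta ` A :: ('g \<Rightarrow>\<^sub>0 'k::comm_ring_1) set) = supported A"
proof
  show "kG0.span (delta ` A :: ('g \<Rightarrow>\<^sub>0 'k) set) \<subseteq> supported A"
    by (rule kG0.span_minimal [OF _ subspace_supported]) (auto simp: supported_def)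
  show "supported A \<subseteq> kG0.span (delta ` A :: ('g \<Rightarrow>\<^sub>0 'k) set)"
  proof
    fix p :: "'g \<Rightarrow>\<^sub>0 'k"
    assume p: "p \<in> supported A"
    have "(\<Sum>g\<in>Poly_Mapping.keys p. kG0_scale (Poly_Mapping.lookup p g) (delta g))
      \<in> kG0.span (delta ` A)"
      using p by (intro kG0.span_sum kG0.span_scale kG0.span_base) (auto simp: supported_def)
    then show "p \<in> kG0.span (delta ` A)"
      by (simp add: kG0_scale_single sum_single_lookup)
  qed
qed

text \<open>The standard basis gives the upper bound. For the lower bound, expanding basis vectors
  in arbitrary generators and reading off coordinates factors the identity matrix.\<close>

lemma rank_supported:
  assumes "finite A"
  shows "kG0.rank (supported A :: ('g \<Rightarrow>\<^sub>0 'k::comm_ring_1) set) = card A"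
proof (rule antisym)
  have fin: "finite (delta ` A :: ('g \<Rightarrow>\<^sub>0 'k) set)"
    using assms by simp
  show "kG0.rank (supported A :: ('g \<Rightarrow>\<^sub>0 'k) set) \<le> card A"
    using kG0.rank_span_le_card [OF fin] card_image_le [OF assms, of delta]
    unfolding span_delta by (rule order_trans)
  obtain B :: "('g \<Rightarrow>\<^sub>0 'k) set" where B: "finite B" "card B = kG0.rank (supported A :: ('g \<Rightarrow>\<^sub>0 'k) set)"
    "kG0.span B = supported A"
    using kG0.rank_attained [OF fin] unfolding span_delta by metis
  have "\<exists>u. delta x = (\<Sum>b\<in>B. kG0_scale (u b) b)" if "x \<in> A" for x
  proof -
    have "delta x \<in> kG0.span B"
      using that B(3) by (simp add: supported_def)
    then show ?thesis
      unfolding kG0.span_finite [OF B(1)] by blast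
  qed
  then obtain c where c: "delta x = (\<Sum>b\<in>B. kG0_scale (c x b) b)" if "x \<in> A" for x
    by metis
  \<comment> \<open>The two factors are the coefficients \<open>c x b\<close> of
    \<open>delta x\<close> and the coordinates of the generators \<open>b\<close> at the points of
    \<open>A\<close>.\<close>
  have "card A \<le> card B"
  proof (rule card_le_of_identity_factorization [OF assms B(1)])
    fix x y assume "x \<in> A" "y \<in> A"
    then have "(\<Sum>b\<in>B. c x b * Poly_Mapping.lookup b y) = Poly_Mapping.lookup (delta x :: 'g \<Rightarrow>\<^sub>0 'k) y"
      by (simp add: c lookup_sum)
    then show "(\<Sum>b\<in>B. c x b * Poly_Mapping.lookup b y) = (if x = y then 1 else 0)"
      by (simp add: lookup_single when_def)
  qed
  then show "card A \<le> kG0.rank (supported A :: ('g \<Rightarrow>\<^sub>0 'k) set)"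
    using B(2) by simp
qed


section \<open>Coordinate subspaces as almost invariant subspaces\<close>

text \<open>Only nonvanishing products count: a point that leaves \<open>A\<close> along
  \<open>k\<close> without lengths adding up does no harm, which is what makes dead ends
  useful.\<close>

definition inner_boundary :: "'g::group_add set \<Rightarrow> 'g set \<Rightarrow> 'g set \<Rightarrow> 'g set"
  where "inner_boundary S K A =
    {x \<in> A. \<exists>k\<in>K. word_length S (x + k) = word_length S x + word_length S k \<and> x + k \<notin> A}"

text \<open>Each term of the product is either zero or sits at a point \<open>x + k\<close> of
  \<open>A\<close>, because \<open>x\<close> is off the boundary.\<close>

lemma delta_mult_supported:
  fixes q :: "'g::group_add \<Rightarrow>\<^sub>0 'k::comm_ring_1"
  assumes "x \<in> A - inner_boundary S K A" "q \<in> supported K"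
  shows "kG0_mult S (delta x) q \<in> supported A"
proof -
  have "kG0_mult S (delta x) q = (\<Sum>k\<in>Poly_Mapping.keys q.
      if word_length S (x + k) = word_length S x + word_length S k
      then Poly_Mapping.single (x + k) (Poly_Mapping.lookup q k) else 0)"
    by (subst kG0_mult_superset [where A = "{x}" and B = "Poly_Mapping.keys q"]) (auto intro!: sum.cong)
  also have "\<dots> \<in> supported A"
    using assms by (intro kG0.subspace_sum subspace_supported)
      (auto simp: supported_def inner_boundary_def)
  finally show ?thesis .
qed

text \<open>This exhibits generators of F + FS' for F = k^A: products starting off the boundary
  already lie in k^A, so only those starting in \<open>B\<close> are added to the basis.\<close>

lemma sum_with_product_eq_span:
  fixes T :: "('g::group_add \<Rightarrow>\<^sub>0 'k::comm_ring_1) set" and S A K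
  assumes "T \<subseteq> supported K"
  defines "B \<equiv> inner_boundary S K A"
  shows "{x + y | x y. x \<in> supported A \<and>
      y \<in> kG0.span {kG0_mult S f s | f s. f \<in> supported A \<and> s \<in> kG0.span T}} =
    kG0.span (delta ` A \<union> (\<lambda>(x, t). kG0_mult S (delta x) t) ` (B \<times> T))"
    (is "_ = kG0.span ?W")
proof -
  let ?M = "{kG0_mult S f s | f s. f \<in> supported A \<and> s \<in> kG0.span T}"
  have gen: "kG0_mult S (delta x) t \<in> kG0.span ?W" if "x \<in> A" "t \<in> T" for x t
  proof (cases "x \<in> B")
    case True
    with that show ?thesis by (intro kG0.span_base) auto
  next
    case False
    then have "kG0_mult S (delta x) t \<in> kG0.span (delta ` A)"
      using that assms unfolding span_delta by (intro delta_mult_supported [where K = K]) auto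
    then show ?thesis
      using kG0.span_mono by blast
  qed
  \<comment> \<open>Bilinearity extends \<open>gen\<close> first from \<open>T\<close> to its span,
    then from basis vectors to all of \<open>supported A\<close>: in each case the admissible
    arguments form a subspace.\<close>
  have "kG0_mult S (delta x) s \<in> kG0.span ?W" if "x \<in> A" "s \<in> kG0.span T" for x s
  proof -
    have "kG0.subspace {s. kG0_mult S (delta x) s \<in> kG0.span ?W}"
      by (auto simp: kG0.subspace_def kG0_mult_add_right kG0_mult_scale_right
        intro: kG0.span_zero kG0.span_add kG0.span_scale)
    moreover have "T \<subseteq> {s. kG0_mult S (delta x) s \<in> kG0.span ?W}"
      using gen [OF that(1)] by blast
    ultimately have "kG0.span T \<subseteq> {s. kG0_mult S (delta x) s \<in> kG0.span ?W}"
      by (intro kG0.span_minimal)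
    with that(2) show ?thesis by blast
  qed
  then have "delta ` A \<subseteq> {f. kG0_mult S f s \<in> kG0.span ?W}" if "s \<in> kG0.span T" for s
    using that by blast
  moreover have "kG0.subspace {f. kG0_mult S f s \<in> kG0.span ?W}" for s
    by (auto simp: kG0.subspace_def kG0_mult_add_left kG0_mult_scale_left
      intro: kG0.span_zero kG0.span_add kG0.span_scale)
  ultimately have "supported A \<subseteq> {f. kG0_mult S f s \<in> kG0.span ?W}" if "s \<in> kG0.span T" for s
    unfolding span_delta [symmetric] using that by (intro kG0.span_minimal)
  then have M: "?M \<subseteq> kG0.span ?W"
    by blast
  have "kG0.span (delta ` A \<union> ?M) = kG0.span ?W"
    unfolding kG0.span_eq
  proof
    show "delta ` A \<union> ?M \<subseteq> kG0.span ?W"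
      using M by (auto intro: kG0.span_base)
    have "kG0_mult S (delta x) t \<in> ?M" if "x \<in> B" "t \<in> T" for x t
    proof -
      have "delta x \<in> supported A"
        using that(1) by (simp add: supported_def B_def inner_boundary_def)
      with kG0.span_base [OF that(2)] show ?thesis by blast
    qed
    then show "?W \<subseteq> kG0.span (delta ` A \<union> ?M)"
      by (intro subset_trans [OF _ kG0.span_superset]) auto
  qed
  then show ?thesis
    unfolding kG0.span_Un span_delta .
qed

text \<open>Reduction to a purely combinatorial condition on subsets of the group. \<open>E\<close>
  is the subspace S' of the algebra that acts; \<open>X\<close> allows F to contain a prescribed
  subspace.\<close>

lemma ex_almost_invariant:
  fixes S X :: "'g::group_add set" and E :: "('g \<Rightarrow>\<^sub>0 'k::comm_ring_1) set"
  assumes "generates S"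
    and A: "\<And>K c. finite K \<Longrightarrow>
      \<exists>A. finite A \<and> X \<subseteq> A \<and> c * card (inner_boundary S K A) < card A"
    and "\<epsilon> > 0" "kG0.finite_rank_subspace E"
  shows "\<exists>F. supported X \<subseteq> F \<and> right_module_over.almost_invariant kG0_scale (kG0_mult S) \<epsilon> E F"
proof -
  interpret algebra_over "kG0_scale :: 'k \<Rightarrow> ('g \<Rightarrow>\<^sub>0 'k) \<Rightarrow> _" "kG0_mult S" "delta 0"
    by (rule algebra_kG0) fact
  interpret right_module_over "kG0_scale :: 'k \<Rightarrow> ('g \<Rightarrow>\<^sub>0 'k) \<Rightarrow> _" "kG0_mult S" "delta 0"
      kG0_scale "kG0_mult S"
    by (rule right_module_over_itself)
  obtain T where T: "finite T" "kG0.span T = E"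
    using assms(4) unfolding kG0.finite_rank_subspace_def by blast
  define K where "K = (\<Union>t\<in>T. Poly_Mapping.keys t)"
  have K: "finite K" "T \<subseteq> supported K"
    using T(1) by (auto simp: K_def supported_def)
  \<comment> \<open>With c at least |T| / \<epsilon>, the rank excess |B| |T| is at most \<epsilon>
    c |B|, hence less than \<epsilon> |A|.\<close>
  obtain c :: nat where "real (card T) / \<epsilon> < real c"
    using reals_Archimedean2 by blast
  then have c: "real (card T) \<le> \<epsilon> * real c"
    using \<open>\<epsilon> > 0\<close> by (simp add: field_simps)
  obtain A where A: "finite A" "X \<subseteq> A" "c * card (inner_boundary S K A) < card A"
    using A [OF K(1)] by blast
  define B where "B = inner_boundary S K A"
  have "finite B"
    using A(1) by (simp add: B_def inner_boundary_def)
  let ?F = "supported A :: ('g \<Rightarrow>\<^sub>0 'k) set"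
  let ?D = "delta ` A :: ('g \<Rightarrow>\<^sub>0 'k) set" and ?P = "(\<lambda>(x, t). kG0_mult S (delta x) t) ` (B \<times> T)"
  have "kG0.rank (kG0.span (?D \<union> ?P)) \<le> card (?D \<union> ?P)"
    using A(1) T(1) \<open>finite B\<close> by (intro kG0.rank_span_le_card) auto
  also have "\<dots> \<le> card ?D + card ?P"
    by (rule card_Un_le)
  also have "\<dots> \<le> card A + card B * card T"
    using A(1) T(1) \<open>finite B\<close> card_image_le [of "B \<times> T" "\<lambda>(x, t). kG0_mult S (delta x) t"]
    by (intro add_mono card_image_le) (auto simp: card_cartesian_product)
  finally have "kG0.rank {x + y | x y. x \<in> ?F \<and> y \<in> subspace_product ?F E} \<le> card A + card B * card T"
    unfolding subspace_product_def T(2) [symmetric] sum_with_product_eq_span [OF K(2)] B_def .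
  then have "real (kG0.rank {x + y | x y. x \<in> ?F \<and> y \<in> subspace_product ?F E}) - real (card A)
      \<le> real (card B) * real (card T)"
    by (simp flip: of_nat_mult)
  also have "\<dots> \<le> real (card B) * (\<epsilon> * real c)"
    using c by (rule mult_left_mono) simp
  also have "\<dots> = \<epsilon> * real (c * card B)"
    by simp
  also have "\<dots> < \<epsilon> * real (card A)"
    using A(3) \<open>\<epsilon> > 0\<close> unfolding B_def by (intro mult_strict_left_mono of_nat_less_iff [THEN iffD2])
  \<comment> \<open>The strict inequality in the choice of \<open>A\<close> also forces
    \<open>A\<close> to be nonempty, so the rank is positive.\<close>
  finally have "almost_invariant \<epsilon> E ?F"
    using A unfolding almost_invariant_def kG0.finite_rank_subspace_def rank_supported [OF A(1)]
    by (auto simp: subspace_supported divide_less_eq intro!: exI [of _ ?D] span_delta)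
  moreover have "supported X \<subseteq> ?F"
    using A(2) by (auto simp: supported_def)
  ultimately show ?thesis by blast
qed


section \<open>Subsets of the group with small boundary\<close>

text \<open>A finite group is its own boundaryless set. Otherwise take a Foelner set
  \<open>F\<close> together with \<open>X\<close>: the boundary has at most |X| + m d points, where
  d counts the points of FK' outside \<open>F\<close>. Largeness of \<open>F\<close> absorbs the
  first summand, its Foelner property the second.\<close>

lemma ex_small_boundary_amenable:
  fixes X K :: "'g::group_add set" and c :: nat
  assumes "amenable_group TYPE('g)" "finite X" "finite K"
  shows "\<exists>A. finite A \<and> X \<subseteq> A \<and> c * card (inner_boundary S K A) < card A"
proof (cases "finite (UNIV :: 'g set)")
  case True
  have "inner_boundary S K UNIV = {}"
    by (simp add: inner_boundary_def)
  with True show ?thesis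
    by (intro exI [of _ UNIV]) (simp add: finite_UNIV_card_ge_0)
next
  case False
  \<comment> \<open>Adding many elements to \<open>K\<close> forces the Foelner set to be large compared with \<open>X\<close>.\<close>
  obtain L :: "'g set" where L: "finite L" "card L = 4 * c * card X"
    using infinite_arbitrarily_large [OF False] by blast
  define K' where "K' = K \<union> L"
  define m where "m = card K'"
  have K': "finite K'" "4 * c * card X \<le> m"
    using assms(3) L card_mono [of K' L] by (auto simp: K'_def m_def)
  \<comment> \<open>Chosen so that 2 c m d \<le> d N < |F|, which uses up half of the bound 2 |F|;
    the added 1 keeps \<open>N\<close> positive and gives d \<le> d N.\<close>
  define N where "N = 2 * c * m + 1"
  have "1 / real N > 0"
    by (simp add: N_def del: of_nat_add of_nat_Suc)
  then obtain F :: "'g set" where F: "finite F" "F \<noteq> {}" and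
    less: "(real (card (F \<union> {f + k | f k. f \<in> F \<and> k \<in> K'})) - real (card F)) / real (card F) < 1 / real N"
    using assms(1) K'(1) unfolding amenable_group_def by blast
  define FK where "FK = {f + k | f k. f \<in> F \<and> k \<in> K'}"
  have "FK = (\<lambda>(f, k). f + k) ` (F \<times> K')"
    by (auto simp: FK_def)
  then have "finite FK"
    using F(1) K'(1) by simp
  define d where "d = card (FK - F)"
  have d: "card (F \<union> FK) = card F + d"
    using card_Un_disjoint [of F "FK - F"] F(1) \<open>finite FK\<close> by (simp add: d_def)
  have "card F > 0"
    using F by (simp add: card_gt_0_iff)
  then have "real d * real N < real (card F)"
    using less \<open>1 / real N > 0\<close> unfolding FK_def [symmetric] d by (simp add: field_simps)
  then have dF: "d * N < card F"
    by (simp only: of_nat_mult [symmetric] of_nat_less_iff)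
  obtain f where "f \<in> F"
    using F(2) by blast
  \<comment> \<open>A translate of \<open>K'\<close> lies in FK', so 4 c |X| \<le> m \<le> |F| + d <
    2 |F|; this is where the constant 4 in the size of \<open>L\<close> comes from.\<close>
  have "m = card ((+) f ` K')"
    by (simp add: m_def card_image)
  also have "\<dots> \<le> card (F \<union> FK)"
    using F(1) \<open>finite FK\<close> \<open>f \<in> F\<close> by (intro card_mono) (auto simp: FK_def)
  finally have "m \<le> card F + d"
    by (simp add: d)
  moreover have "d \<le> d * N"
    by (simp add: N_def)
  ultimately have XF: "2 * (c * card X) \<le> card F"
    using dF K'(2) by linarith
  \<comment> \<open>A boundary point outside \<open>X\<close> lies in \<open>F\<close> and is
    recovered as \<open>y - k\<close> from its exit point \<open>y\<close> in
    \<open>FK - F\<close>.\<close>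
  have "inner_boundary S K (F \<union> X) \<subseteq> X \<union> (\<Union>k\<in>K'. (\<lambda>y. y - k) ` (FK - F))"
    by (force simp: inner_boundary_def FK_def K'_def intro: rev_image_eqI)
  moreover have "finite (X \<union> (\<Union>k\<in>K'. (\<lambda>y. y - k) ` (FK - F)))"
    using assms(2) K'(1) \<open>finite FK\<close> by simp
  ultimately have "card (inner_boundary S K (F \<union> X)) \<le> card (X \<union> (\<Union>k\<in>K'. (\<lambda>y. y - k) ` (FK - F)))"
    by (intro card_mono)
  also have "\<dots> \<le> card X + card (\<Union>k\<in>K'. (\<lambda>y. y - k) ` (FK - F))"
    by (rule card_Un_le)
  also have "card (\<Union>k\<in>K'. (\<lambda>y. y - k) ` (FK - F)) \<le> (\<Sum>k\<in>K'. card ((\<lambda>y. y - k) ` (FK - F)))"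
    by (rule card_UN_le [OF K'(1)])
  also have "\<dots> \<le> (\<Sum>k\<in>K'. d)"
    unfolding d_def using \<open>finite FK\<close> by (intro sum_mono card_image_le) simp
  also have "\<dots> = m * d"
    by (simp add: m_def)
  finally have "card (inner_boundary S K (F \<union> X)) \<le> card X + m * d"
    by simp
  then have "2 * (c * card (inner_boundary S K (F \<union> X))) \<le> 2 * (c * card X) + 2 * (c * (m * d))"
    using mult_le_mono2 [of _ _ "2 * c"] by (metis distrib_left mult.assoc)
  also have "2 * (c * (m * d)) \<le> d * N"
    by (simp add: N_def algebra_simps)
  finally have "c * card (inner_boundary S K (F \<union> X)) < card F"
    using dF XF by linarith
  also have "\<dots> \<le> card (F \<union> X)"
    using F(1) assms(2) by (intro card_mono) auto
  finally show ?thesis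
    using F(1) assms(2) by (intro exI [of _ "F \<union> X"]) auto
qed

section \<open>Dead ends\<close>

text \<open>A shortest word for \<open>k\<close> is nonempty, and its first letter does not increase
  the length when applied at a dead end; only the remaining letters can.\<close>

lemma word_length_dead_end_add:
  assumes "generates S" "dead_end S g" "k \<noteq> 0"
  shows "word_length S (g + k) < word_length S g + word_length S k"
proof -
  obtain ws where ws: "length ws = word_length S k" "set ws \<subseteq> S" "sum_list ws = k"
    using word_length_attained [OF assms(1)] .
  with assms(3) obtain s us where s: "ws = s # us"
    by (cases ws) auto
  have "word_length S (g + k) \<le> word_length S (g + s) + word_length S (sum_list us)"
    using word_length_add_le [OF assms(1), of "g + s" "sum_list us"] ws s by (simp add: add.assoc)
  also have "word_length S (g + s) \<le> word_length S g"
    using assms(2) ws s by (simp add: dead_end_def)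
  also have "word_length S (sum_list us) \<le> length us"
    using ws s by (intro word_length_le) auto
  finally show ?thesis
    using ws s by simp
qed

text \<open>Leaving a set requires \<open>k \<noteq> 0\<close>, and from a dead end lengths never
  add up for such \<open>k\<close>.\<close>

lemma inner_boundary_dead_ends:
  assumes "generates S" "\<And>g. g \<in> D \<Longrightarrow> dead_end S g"
  shows "inner_boundary S K (X \<union> D) \<subseteq> X"
proof
  fix x assume "x \<in> inner_boundary S K (X \<union> D)"
  then obtain k where k: "x \<in> X \<union> D" "x + k \<notin> X \<union> D"
      "word_length S (x + k) = word_length S x + word_length S k"
    unfolding inner_boundary_def by blast
  then have "k \<noteq> 0" by auto
  with k show "x \<in> X"
    using word_length_dead_end_add [OF assms(1) assms(2)] by fastforce
qed

lemma ex_small_boundary_dead_ends: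
  assumes "generates S" "infinite {g. dead_end S g}" "finite X"
  shows "\<exists>A. finite A \<and> X \<subseteq> A \<and> c * card (inner_boundary S K A) < card A"
proof -
  \<comment> \<open>The boundary stays inside \<open>X\<close> however large \<open>D\<close> is;
    the added 1 makes the inequality strict.\<close>
  obtain D where D: "finite D" "card D = c * card X + 1" "D \<subseteq> {g. dead_end S g}"
    using infinite_arbitrarily_large [OF assms(2)] by blast
  have "c * card (inner_boundary S K (X \<union> D)) \<le> c * card X"
    using D(3) by (intro mult_le_mono2 card_mono assms(3) inner_boundary_dead_ends [OF assms(1)]) auto
  also have "\<dots> < card D"
    using D(2) by simp
  also have "\<dots> \<le> card (X \<union> D)"
    using D(1) assms(3) by (intro card_mono) auto
  finally show ?thesis
    using D(1) assms(3) by (intro exI [of _ "X \<union> D"]) auto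
qed

section \<open>Amenability and exhaustive amenability of the algebra\<close>

theorem theorem1p4:
  fixes S :: "'g::group_add set"
  assumes "finite S" and "generates S"
  shows "(amenable_group TYPE('g) \<or> (\<exists>g. dead_end S g) \<longrightarrow>
            algebra_over.amenable_algebra
              (kG0_scale :: 'k::comm_ring_1 \<Rightarrow> ('g \<Rightarrow>\<^sub>0 'k) \<Rightarrow> ('g \<Rightarrow>\<^sub>0 'k)) (kG0_mult S)) \<and>
         (amenable_group TYPE('g) \<or> infinite {g. dead_end S g} \<longrightarrow>
            algebra_over.exhaustively_amenable_algebra
              (kG0_scale :: 'k \<Rightarrow> ('g \<Rightarrow>\<^sub>0 'k) \<Rightarrow> ('g \<Rightarrow>\<^sub>0 'k)) (kG0_mult S))"
proof -
  interpret algebra_over "kG0_scale :: 'k \<Rightarrow> ('g \<Rightarrow>\<^sub>0 'k) \<Rightarrow> _" "kG0_mult S" "delta 0"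
    by (rule algebra_kG0) fact
  interpret right_module_over "kG0_scale :: 'k \<Rightarrow> ('g \<Rightarrow>\<^sub>0 'k) \<Rightarrow> _" "kG0_mult S" "delta 0"
      kG0_scale "kG0_mult S"
    by (rule right_module_over_itself)
  have "amenable_algebra" if "amenable_group TYPE('g) \<or> (\<exists>g. dead_end S g)"
    unfolding amenable_algebra_def amenable_module_def
  proof (intro allI impI)
    fix \<epsilon> :: real and E :: "('g \<Rightarrow>\<^sub>0 'k) set"
    assume "\<epsilon> > 0" "kG0.finite_rank_subspace E"
    moreover have "\<exists>A. finite A \<and> {} \<subseteq> A \<and> c * card (inner_boundary S K A) < card A" if "finite K" for K c
      using \<open>amenable_group TYPE('g) \<or> (\<exists>g. dead_end S g)\<close>
    proof
      assume "amenable_group TYPE('g)"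
      then show ?thesis
        using that by (intro ex_small_boundary_amenable) auto
    next
      assume "\<exists>g. dead_end S g"
      then obtain g where "dead_end S g" ..
      \<comment> \<open>A single dead end suffices when nothing has to be contained in F: its
        singleton has empty boundary for every \<open>K\<close>.\<close>
      then have "inner_boundary S K {g} = {}"
        using inner_boundary_dead_ends [OF assms(2), of "{g}" K "{}"] by simp
      then show ?thesis
        by (intro exI [of _ "{g}"]) simp
    qed
    ultimately show "\<exists>F. almost_invariant \<epsilon> E F"
      using ex_almost_invariant [OF assms(2), of "{}"] by blast
  qed
  moreover have "exhaustively_amenable_algebra"
    if hyp: "amenable_group TYPE('g) \<or> infinite {g. dead_end S g}"
    unfolding exhaustively_amenable_algebra_def exhaustively_amenable_module_def
  proof (intro allI impI)
    fix \<epsilon> :: real and E E' :: "('g \<Rightarrow>\<^sub>0 'k) set"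
    assume E: "\<epsilon> > 0" "kG0.finite_rank_subspace E" "kG0.finite_rank_subspace E'"
    from E(3) obtain T where T: "finite T" "kG0.span T = E'"
      unfolding kG0.finite_rank_subspace_def by blast
    \<comment> \<open>\<open>E'\<close> is the subspace to be contained in F. The supports of its
      generators form a finite set \<open>X\<close> with \<open>E'\<close> inside k^X, so containing
      k^X is enough.\<close>
    define X where "X = (\<Union>t\<in>T. Poly_Mapping.keys t)"
    have "finite X"
      using T(1) by (simp add: X_def)
    have "E' \<subseteq> supported X"
      unfolding T(2) [symmetric]
      by (rule kG0.span_minimal [OF _ subspace_supported]) (auto simp: X_def supported_def)
    moreover have "\<exists>A. finite A \<and> X \<subseteq> A \<and> c * card (inner_boundary S K A) < card A" if "finite K" for K c
      using hyp that \<open>finite X\<close> ex_small_boundary_amenable ex_small_boundary_dead_ends [OF assms(2)] by metis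
    ultimately show "\<exists>F. E' \<subseteq> F \<and> almost_invariant \<epsilon> E F"
      using ex_almost_invariant [OF assms(2) _ E(1,2)] by (meson subset_trans)
  qed
  ultimately show ?thesis by blast
qed

end
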